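(* For every integer $n>0$, $$\sum_{k=0}^{n-1}(-1)^k q^{-\binom{k}{2}}C_k^q\equiv F_n^q(q)+F_{n+2}^q(1)-2\pmod{\Phi_n(q)},$$ and, with $r(n)=\lfloor n/5+\tfrac12\rfloor$, $$F_n^q(q)+F_{n+2}^q(1)\equiv\begin{cases}(-1)^{r(n)}\left(q^{\frac{r(n)(n-1)}{2}}+q^{\frac{r(n)(n+1)}{2}}\right) & \text{if } n\equiv 0,2,3\pmod 5,\\[6pt] (-1)^{r(n)}\left(q^{\frac{r(n)(n-2)}{2}}+q^{\frac{r(n)n}{2}}+q^{\frac{r(n)(n+2)}{2}}\right) & \text{if } n\equiv 1,4\pmod 5,\end{cases}\pmod{\Phi_n(q)}.$$
   Context: The Gaussian $q$-binomial coefficient $\binom{n}{k}_q$ is the polynomial in $q$ given by $\binom{n}{k}_q=\dfrac{(q;q)_n}{(q;q)_k(q;q)_{n-k}}$ if $0\le k\le n$ and $\binom{n}{k}_q=0$ otherwise, where $(z;q)_n=\prod_{j=0}^{n-1}(1-zq^j)$. The $q$-Catalan number is the polynomial $C_n^q=\dfrac{1}{[n+1]_q}\binom{2n}{n}_q=\binom{2n}{n}_q-q\binom{2n}{n+1}_q$, where $[n+1]_q=\dfrac{1-q^{n+1}}{1-q}$. In the exponent, $\binom{k}{2}=k(k-1)/2$ is the ordinary binomial coefficient. The $q$-Fibonacci polynomials $F_n^q(t)$ are defined by $F_0^q(t)=0$, $F_1^q(t)=1$ and $F_n^q(t)=F_{n-1}^q(t)+q^{n-2}t\,F_{n-2}^q(t)$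 for $n\ge 2$; $F_n^q(q)$ and $F_{n+2}^q(1)$ denote the substitutions $t=q$ and $t=1$. $\Phi_n(q)=\prod_{0\le m<n,\ \gcd(m,n)=1}(q-e^{2\pi m i/n})$ is the $n$-th cyclotomic polynomial. Congruences modulo $\Phi_n(q)$ are in the Laurent polynomial ring $\mathbb{Z}[q,q^{-1}]$ (equivalently, both sides agree at every primitive $n$-th root of unity $q$). *)

theory Defs
  imports
    Complex_Main
    "HOL-Computational_Algebra.Polynomial"
    "HOL-Library.Poly_Mapping"
begin

section \<open>q-analogues as integer polynomials\<close>

abbreviation qvar :: "int poly" where
  "qvar \<equiv> [:0, 1:]"

definition qpochhammer :: "int poly \<Rightarrow> nat \<Rightarrow> int poly" where
  "qpochhammer z n = (\<Prod>j<n. 1 - z * qvar ^ j)"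

text \<open>In the following definitions \<open>div\<close> is division in the integral domain of
  integer polynomials. It is exact in every case: see \<open>qbinomial_exact\<close>, \<open>qint_exact\<close> and
  \<open>qcatalan_exact\<close>.\<close>

definition qbinomial :: "nat \<Rightarrow> nat \<Rightarrow> int poly" where
  "qbinomial n k =
     (if k \<le> n
      then qpochhammer qvar n div (qpochhammer qvar k * qpochhammer qvar (n - k))
      else 0)"

definition qint :: "nat \<Rightarrow> int poly" where
  "qint n = (1 - qvar ^ n) div (1 - qvar)"

definition qcatalan :: "nat \<Rightarrow> int poly" where
  "qcatalan n = qbinomial (2 * n) n div qint (n + 1)"

text \<open>Polynomials in \<open>t\<close> whose coefficients are polynomials in \<open>q\<close>; the substitution \<open>t = s\<close> is
  \<^term>\<open>\<lambda>n s. poly (qfib n) s\<close>.\<close>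

fun qfib :: "nat \<Rightarrow> int poly poly" where
  "qfib 0 = 0"
| "qfib (Suc 0) = 1"
| "qfib (Suc (Suc n)) = qfib (Suc n) + monom (qvar ^ n) 1 * qfib n"


section \<open>Cyclotomic polynomials\<close>

definition cyclotomic_complex :: "nat \<Rightarrow> complex poly" where
  "cyclotomic_complex n =
     (\<Prod>m | m < n \<and> gcd m n = 1.
        [:- exp (2 * of_real pi * of_nat m * \<i> / of_nat n), 1:])"

text \<open>For \<open>n > 0\<close> the product has integer coefficients (\<open>of_int_poly_cyclotomic\<close>), which makes it
  an element of the integer polynomial ring.\<close>

definition cyclotomic :: "nat \<Rightarrow> int poly" where
  "cyclotomic n = (THE p. map_poly of_int p = cyclotomic_complex n)"


section \<open>Integer Laurent polynomials\<close>

text \<open>Finitely supported functions from exponents to coefficients, with the convolution product: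
  the group ring of the integers over the integers.\<close>

type_synonym laurent = "int \<Rightarrow>\<^sub>0 int"

definition qpow :: "int \<Rightarrow> laurent" where
  "qpow e = Poly_Mapping.single e 1"

definition laurent_of_poly :: "int poly \<Rightarrow> laurent" where
  "laurent_of_poly p = poly (map_poly of_int p) (qpow 1)"

definition laurent_cong :: "laurent \<Rightarrow> laurent \<Rightarrow> int poly \<Rightarrow> bool"
    (\<open>(\<open>indent=1\<close>[_ \<equiv>\<^sub>L _] '(mod _'))\<close>) where
  "[a \<equiv>\<^sub>L b] (mod p) \<longleftrightarrow> laurent_of_poly p dvd a - b"

text \<open>The halves taken in exponents built from \<open>rnd5 n\<close> are exact integers:
  see \<open>rnd5_exponents_even\<close>.\<close>

definition rnd5 :: "nat \<Rightarrow> nat" where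
  "rnd5 n = nat \<lfloor>real n / 5 + 1 / 2\<rfloor>"


section \<open>Well-definedness\<close>

lemma of_int_poly_add:
  "map_poly (of_int :: int \<Rightarrow> 'a::comm_ring_1) (p + r) = map_poly of_int p + map_poly of_int r"
  by (simp add: poly_eq_iff coeff_map_poly)

lemma of_int_poly_mult:
  "map_poly (of_int :: int \<Rightarrow> 'a::comm_ring_1) (p * r) = map_poly of_int p * map_poly of_int r"
  by (simp add: poly_eq_iff coeff_map_poly coeff_mult)

lemma of_int_poly_prod:
  "map_poly (of_int :: int \<Rightarrow> 'a::comm_ring_1) (prod f A) = (\<Prod>x\<in>A. map_poly of_int (f x))"
  by (induction A rule: infinite_finite_induct) (simp_all add: of_int_poly_mult)

lemma laurent_of_poly_add: "laurent_of_poly (p + r) = laurent_of_poly p + laurent_of_poly r"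
  by (simp add: laurent_of_poly_def of_int_poly_add)

lemma laurent_of_poly_mult: "laurent_of_poly (p * r) = laurent_of_poly p * laurent_of_poly r"
  by (simp add: laurent_of_poly_def of_int_poly_mult)

lemma laurent_of_poly_1: "laurent_of_poly 1 = 1"
  by (simp add: laurent_of_poly_def)

lemma qpow_0: "qpow 0 = 1"
  by (simp add: qpow_def)

lemma qpow_add: "qpow (a + b) = qpow a * qpow b"
  by (simp add: qpow_def mult_single)

lemma laurent_of_poly_qvar_power: "laurent_of_poly (qvar ^ n) = qpow (int n)"
  by (induction n)
     (simp_all add: laurent_of_poly_1 laurent_of_poly_mult qpow_0 qpow_add[of 1],
      simp_all add: laurent_of_poly_def map_poly_pCons)

lemma one_minus_qvar_power_neq_0:
  assumes "n > 0"
  shows "1 - qvar ^ n \<noteq> 0"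
proof
  assume "1 - qvar ^ n = 0"
  hence "poly (1 - qvar ^ n) 0 = 0" by simp
  thus False using assms by (simp add: power_0_left)
qed

lemma qpochhammer_0: "qpochhammer z 0 = 1"
  by (simp add: qpochhammer_def)

lemma qpochhammer_qvar_Suc:
  "qpochhammer qvar (Suc n) = qpochhammer qvar n * (1 - qvar ^ Suc n)"
  by (simp add: qpochhammer_def)

lemma qpochhammer_qvar_neq_0: "qpochhammer qvar n \<noteq> 0"
proof (induction n)
  case 0
  show ?case by (simp add: qpochhammer_def)
next
  case (Suc n)
  then show ?case
    using one_minus_qvar_power_neq_0[of "Suc n"] by (simp only: qpochhammer_qvar_Suc mult_eq_0_iff) simp
qed

lemma q_pascal_aux:
  fixes p q :: "'a::comm_ring_1"
  shows "p * (1 - q ^ Suc (Suc (j + i))) = p * (1 - q ^ Suc j) + q ^ Suc j * (p * (1 - q ^ Suc i))"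
  by (simp add: algebra_simps power_add)

lemma q_catalan_aux:
  fixes a b q y :: "'a::comm_ring_1"
  assumes "a * (1 - q ^ n) = b * (1 - q ^ (n + 1))" "y * (1 - q) = 1 - q ^ (n + 1)"
  shows "(1 - q) * (y * (a - q * b)) = (1 - q) * a"
proof -
  have "(1 - q) * (y * (a - q * b)) = (y * (1 - q)) * (a - q * b)"
    by (simp add: algebra_simps)
  also have "\<dots> = (1 - q ^ (n + 1)) * a - q * (b * (1 - q ^ (n + 1)))"
    unfolding assms(2) by (simp add: algebra_simps)
  also have "\<dots> = (1 - q) * a"
    unfolding assms(1)[symmetric] by (simp add: algebra_simps)
  finally show ?thesis .
qed

lemma qpochhammer_qvar_dvd:
  assumes "k \<le> n"
  shows "qpochhammer qvar k * qpochhammer qvar (n - k) dvd qpochhammer qvar n"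
  using assms
proof (induction n arbitrary: k)
  case 0
  then show ?case by (simp add: qpochhammer_0)
next
  case (Suc n)
  let ?P = "qpochhammer qvar"
  consider "k = 0" | "k = Suc n" | j where "k = Suc j" "j < n"
    using Suc.prems by (cases k) force+
  then show ?case
  proof cases
    case (3 j)
    define i where "i = n - Suc j"
    have n: "n = Suc (j + i)" using 3 by (simp add: i_def)
    have d1: "?P j * ?P (Suc i) dvd ?P n" using Suc.IH[of j] n by simp
    have d2: "?P (Suc j) * ?P i dvd ?P n" using Suc.IH[of "Suc j"] n by simp
    have "?P (Suc n) = ?P n * (1 - qvar ^ Suc j) + qvar ^ Suc j * (?P n * (1 - qvar ^ Suc i))"
      using q_pascal_aux[of "?P n" qvar j i] by (simp only: qpochhammer_qvar_Suc[of n, unfolded n] n)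
    moreover have "?P (Suc j) * ?P (Suc i) dvd ?P n * (1 - qvar ^ Suc j)"
      using mult_dvd_mono[OF d1 dvd_refl[of "1 - qvar ^ Suc j"]]
      by (simp only: qpochhammer_qvar_Suc[of j] mult_ac)
    moreover have "?P (Suc j) * ?P (Suc i) dvd ?P n * (1 - qvar ^ Suc i)"
      using mult_dvd_mono[OF d2 dvd_refl[of "1 - qvar ^ Suc i"]]
      by (simp only: qpochhammer_qvar_Suc[of i] mult_ac)
    ultimately have "?P (Suc j) * ?P (Suc i) dvd ?P (Suc n)"
      by (metis dvd_add dvd_mult)
    thus ?thesis using 3 n by simp
  next
    case 1
    then show ?thesis by (simp add: qpochhammer_0)
  next
    case 2
    then show ?thesis by (simp add: qpochhammer_0)
  qed
qed

lemma qbinomial_exact: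
  assumes "k \<le> n"
  shows "qbinomial n k * (qpochhammer qvar k * qpochhammer qvar (n - k)) = qpochhammer qvar n"
  using qpochhammer_qvar_dvd[OF assms] assms by (simp add: qbinomial_def)

lemma qint_exact: "qint n * (1 - qvar) = 1 - qvar ^ n"
proof -
  have "1 - qvar ^ n = (1 - qvar) * (\<Sum>i<n. qvar ^ i)"
    by (rule one_diff_power_eq)
  hence "1 - qvar dvd 1 - qvar ^ n" by (metis dvd_triv_left)
  thus ?thesis unfolding qint_def by (rule dvd_div_mult_self)
qed

lemma qint_neq_0: "n > 0 \<Longrightarrow> qint n \<noteq> 0"
  using qint_exact[of n] one_minus_qvar_power_neq_0[of n] by (metis mult_zero_left)

lemma qcatalan_aux:
  "qint (n + 1) * (qbinomial (2 * n) n - qvar * qbinomial (2 * n) (n + 1)) = qbinomial (2 * n) n"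
proof -
  let ?P = "qpochhammer qvar"
  let ?A = "qbinomial (2 * n) n" and ?B = "qbinomial (2 * n) (n + 1)"
  have rel: "?A * (1 - qvar ^ n) = ?B * (1 - qvar ^ (n + 1))"
  proof (cases n)
    case 0
    then show ?thesis by (simp add: qbinomial_def)
  next
    case (Suc m)
    have [simp]: "Suc (2 * m) - m = Suc m" by simp
    have "?A * (?P n * ?P n) = ?P (2 * n)"
      using qbinomial_exact[of n "2 * n"] by (simp add: mult_2)
    moreover have "?B * (?P (Suc n) * ?P m) = ?P (2 * n)"
      using qbinomial_exact[of "n + 1" "2 * n"] Suc by (simp add: mult_2)
    ultimately have "?A * (?P n * (?P m * (1 - qvar ^ n))) = ?B * (?P n * (1 - qvar ^ Suc n) * ?P m)"
      using qpochhammer_qvar_Suc[of m] qpochhammer_qvar_Suc[of n] Suc by metis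
    hence "(?P n * ?P m) * (?A * (1 - qvar ^ n)) = (?P n * ?P m) * (?B * (1 - qvar ^ (n + 1)))"
      by (simp only: mult_ac Suc_eq_plus1)
    moreover have "?P n * ?P m \<noteq> 0" using qpochhammer_qvar_neq_0 by simp
    ultimately show ?thesis by (metis mult_left_cancel)
  qed
  have "(1 - qvar) * (qint (n + 1) * (?A - qvar * ?B)) = (1 - qvar) * ?A"
    by (rule q_catalan_aux[OF rel qint_exact])
  thus ?thesis
    using one_minus_qvar_power_neq_0[of 1] by (metis mult_left_cancel power_one_right zero_less_one)
qed

lemma qcatalan_exact: "qint (n + 1) * qcatalan n = qbinomial (2 * n) n"
  unfolding qcatalan_def using qcatalan_aux[of n] by (metis dvd_mult_div_cancel dvd_triv_left)

lemma qcatalan_eq: "qcatalan n = qbinomial (2 * n) n - qvar * qbinomial (2 * n) (n + 1)"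
  using qcatalan_aux[of n] qcatalan_exact[of n] qint_neq_0[of "n + 1"]
  by (metis add_gr_0 mult_left_cancel zero_less_one)

lemma cyclotomic_complex_altdef:
  "cyclotomic_complex n = (\<Prod>m | m < n \<and> gcd m n = 1. [:- cis (2 * pi * real m / real n), 1:])"
  unfolding cyclotomic_complex_def by (simp add: cis_conv_exp mult_ac)

lemma lead_coeff_cyclotomic_complex: "lead_coeff (cyclotomic_complex n) = 1"
  by (simp add: cyclotomic_complex_def lead_coeff_prod)

lemma prod_roots_unity:
  assumes "n > 0"
  shows "(\<Prod>k<n. [:- cis (2 * pi * real k / real n), 1:]) = monom 1 n - 1"
proof (rule poly_eqI_degree_lead_coeff[where A = "{z. z ^ n = 1}" and n = n])
  show "coeff (\<Prod>k<n. [:- cis (2 * pi * real k / real n), 1:]) n = coeff (monom 1 n - 1) n"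
  proof -
    have "degree (\<Prod>k<n. [:- cis (2 * pi * real k / real n), 1:]) = n"
      by (subst degree_prod_eq_sum_degree) auto
    moreover have "lead_coeff (\<Prod>k<n. [:- cis (2 * pi * real k / real n), 1:]) = 1"
      by (simp add: lead_coeff_prod)
    ultimately show ?thesis using assms by simp
  qed
next
  show "degree (\<Prod>k<n. [:- cis (2 * pi * real k / real n), 1:]) \<le> n"
    by (subst degree_prod_eq_sum_degree) auto
next
  show "degree (monom 1 n - 1 :: complex poly) \<le> n"
    by (intro degree_diff_le) (auto simp: degree_monom_eq)
next
  show "n \<le> card {z::complex. z ^ n = 1}" using card_roots_unity_eq[OF assms] by simp
next
  fix z :: complex assume z: "z \<in> {z. z ^ n = 1}"
  hence "z \<in> (\<lambda>k. cis (2 * pi * real k / real n)) ` {..<n}"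
    using bij_betw_roots_unity[OF assms] by (simp add: bij_betw_def)
  with z show "poly (\<Prod>k<n. [:- cis (2 * pi * real k / real n), 1:]) z = poly (monom 1 n - 1) z"
    by (auto simp: poly_prod poly_monom)
qed

lemma prod_cyclotomic_complex:
  assumes "n > 0"
  shows "(\<Prod>d | d dvd n. cyclotomic_complex d) = monom 1 n - 1"
proof -
  have fin: "finite {d. d dvd n}" using assms by simp
  have "(\<Prod>d | d dvd n. cyclotomic_complex d) =
        (\<Prod>(d, m)\<in>(SIGMA d:{d. d dvd n}. {m. m < d \<and> gcd m d = 1}).
           [:- cis (2 * pi * real m / real d), 1:])"
    unfolding cyclotomic_complex_altdef by (subst prod.Sigma) (use fin in auto)
  also have "\<dots> = (\<Prod>k<n. [:- cis (2 * pi * real k / real n), 1:])"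
  proof (rule prod.reindex_bij_witness[where
        j = "\<lambda>(d, m). m * (n div d)" and i = "\<lambda>k. (n div gcd k n, k div gcd k n)"])
    fix x assume "x \<in> (SIGMA d:{d. d dvd n}. {m. m < d \<and> gcd m d = 1})"
    then obtain d m where x: "x = (d, m)" "d dvd n" "m < d" "gcd m d = 1" by auto
    then obtain e where n: "n = d * e" by auto
    have e: "e > 0" "d > 0" using n assms by auto
    have g: "gcd (m * e) (d * e) = e"
      using x(4) by (metis gcd_mult_distrib_nat mult.commute mult.right_neutral)
    show "(n div gcd (case x of (d, m) \<Rightarrow> m * (n div d)) n,
           (case x of (d, m) \<Rightarrow> m * (n div d)) div gcd (case x of (d, m) \<Rightarrow> m * (n div d)) n) = x"
      using x n e g by simp
    show "(case x of (d, m) \<Rightarrow> m * (n div d)) \<in> {..<n}" using x n e by simp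
    show "[:- cis (2 * pi * real (case x of (d, m) \<Rightarrow> m * (n div d)) / real n), 1:] =
          (case x of (d, m) \<Rightarrow> [:- cis (2 * pi * real m / real d), 1:])"
      using x n e by (simp add: field_simps)
  next
    fix k assume k: "k \<in> {..<n}"
    have g: "gcd k n > 0" using assms by simp
    show "(case (n div gcd k n, k div gcd k n) of (d, m) \<Rightarrow> m * (n div d)) = k"
      using g assms by (simp add: div_div_eq_right)
    have "k div gcd k n < n div gcd k n"
      using k g by (metis div_less_mono dvd_div_eq_0_iff gcd_dvd1 gcd_dvd2 lessThan_iff mod_0_imp_dvd dvd_imp_mod_0)
    moreover have "gcd (k div gcd k n) (n div gcd k n) = 1"
      using assms by (metis div_gcd_coprime coprime_iff_gcd_eq_1 gr_implies_not0)
    ultimately show "(n div gcd k n, k div gcd k n) \<in> (SIGMA d:{d. d dvd n}. {m. m < d \<and> gcd m d = 1})"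
      by (auto intro: dvdI[of _ _ "gcd k n"])
  qed
  also have "\<dots> = monom 1 n - 1" by (rule prod_roots_unity[OF assms])
  finally show ?thesis .
qed

lemma degree_of_int_poly: "degree (map_poly (of_int :: int \<Rightarrow> complex) p) = degree p"
  by (intro degree_map_poly) auto

lemma of_int_poly_inject:
  "map_poly (of_int :: int \<Rightarrow> complex) p = map_poly of_int r \<Longrightarrow> p = r"
  by (simp add: poly_eq_iff coeff_map_poly)

lemma cyclotomic_complex_integral:
  assumes "n > 0"
  shows "\<exists>p :: int poly. map_poly of_int p = cyclotomic_complex n"
  using assms
proof (induction n rule: less_induct)
  case (less n)
  let ?h = "map_poly (of_int :: int \<Rightarrow> complex)"
  let ?D = "{d. d dvd n} - {n}"
  have "\<forall>d\<in>?D. \<exists>p. ?h p = cyclotomic_complex d"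
    using less by (auto dest: dvd_imp_le intro!: less.IH simp: le_less dvd_pos_nat)
  then obtain f where f: "\<And>d. d \<in> ?D \<Longrightarrow> ?h (f d) = cyclotomic_complex d" by metis
  define Q where "Q = (\<Prod>d\<in>?D. f d)"
  have hQ: "?h Q = (\<Prod>d\<in>?D. cyclotomic_complex d)"
    unfolding Q_def of_int_poly_prod using f by (intro prod.cong) auto
  have lc: "lead_coeff (?h Q) = 1"
    unfolding hQ by (simp add: lead_coeff_prod lead_coeff_cyclotomic_complex)
  hence lcQ: "lead_coeff Q = 1" by (simp add: degree_of_int_poly coeff_map_poly)
  hence Q0: "Q \<noteq> 0" by auto
  obtain c r where cr: "pseudo_divmod (monom 1 n - 1) Q = (c, r)" by fastforce
  have div: "monom 1 n - 1 = Q * c + r" "r = 0 \<or> degree r < degree Q"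
    using pseudo_divmod[OF Q0 cr] lcQ by simp_all
  have "?h (monom 1 n - 1) = monom 1 n - 1"
    by (simp add: poly_eq_iff coeff_map_poly)
  hence "?h Q * ?h c + ?h r = monom 1 n - 1"
    using div(1) by (simp add: of_int_poly_add of_int_poly_mult)
  also have "\<dots> = ?h Q * cyclotomic_complex n"
    using less.prems by (simp add: prod_cyclotomic_complex[symmetric] hQ prod.remove[of _ n] mult.commute)
  finally have eq: "?h r = ?h Q * (cyclotomic_complex n - ?h c)"
    by (simp add: algebra_simps)
  have "cyclotomic_complex n - ?h c = 0"
  proof (rule ccontr)
    assume nz: "cyclotomic_complex n - ?h c \<noteq> 0"
    have hQ0: "?h Q \<noteq> 0" using lc by auto
    have "degree (?h r) = degree (?h Q) + degree (cyclotomic_complex n - ?h c)"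
      unfolding eq using nz hQ0 by (rule degree_mult_eq[rotated])
    hence "degree r \<ge> degree Q" by (simp add: degree_of_int_poly)
    hence "r = 0" using div(2) by auto
    thus False using eq nz hQ0 by auto
  qed
  thus ?case by (intro exI[of _ c]) simp
qed

lemma of_int_poly_cyclotomic:
  assumes "n > 0"
  shows "map_poly of_int (cyclotomic n) = cyclotomic_complex n"
proof -
  obtain p :: "int poly" where p: "map_poly of_int p = cyclotomic_complex n"
    using cyclotomic_complex_integral[OF assms] by blast
  show ?thesis unfolding cyclotomic_def
    by (rule theI[of _ p]) (use p in \<open>auto intro: of_int_poly_inject\<close>)
qed

lemma rnd5_altdef: "rnd5 n = (2 * n + 5) div 10"
proof -
  have "real n / 5 + 1 / 2 = real (2 * n + 5) / real 10" by simp
  hence "\<lfloor>real n / 5 + 1 / 2\<rfloor> = int ((2 * n + 5) div 10)"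
    using floor_divide_of_nat_eq[of "2 * n + 5" 10, where 'a = real] by metis
  thus ?thesis by (simp add: rnd5_def)
qed

lemma rnd5_exponents_even:
  "n mod 5 \<in> {0, 2, 3} \<Longrightarrow> even (int (rnd5 n) * (int n - 1))"
  "n mod 5 \<in> {0, 2, 3} \<Longrightarrow> even (int (rnd5 n) * (int n + 1))"
  "n mod 5 \<in> {1, 4} \<Longrightarrow> even (int (rnd5 n) * (int n - 2))"
  "n mod 5 \<in> {1, 4} \<Longrightarrow> even (int (rnd5 n) * int n)"
  "n mod 5 \<in> {1, 4} \<Longrightarrow> even (int (rnd5 n) * (int n + 2))"
proof -
  have "n mod 5 \<in> {0, 2, 3} \<Longrightarrow> even (rnd5 n) \<or> odd n"
       "n mod 5 \<in> {1, 4} \<Longrightarrow> even (rnd5 n) \<or> even n"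
    unfolding rnd5_altdef by (simp; presburger)+
  thus "n mod 5 \<in> {0, 2, 3} \<Longrightarrow> even (int (rnd5 n) * (int n - 1))"
    "n mod 5 \<in> {0, 2, 3} \<Longrightarrow> even (int (rnd5 n) * (int n + 1))"
    "n mod 5 \<in> {1, 4} \<Longrightarrow> even (int (rnd5 n) * (int n - 2))"
    "n mod 5 \<in> {1, 4} \<Longrightarrow> even (int (rnd5 n) * int n)"
    "n mod 5 \<in> {1, 4} \<Longrightarrow> even (int (rnd5 n) * (int n + 2))"
    by auto
qed

end

theory Submission
  imports Defs "HOL-Library.Real_Mod"
begin

text \<open>It suffices to compare values at each primitive \<open>n\<close>-th root of unity \<open>z\<close>.
  There \<open>[n-1-k choose k] = (-1)^k z^(-k(3k+1)/2) [2k choose k]\<close>, because \<open>1 - z^(n-i)\<close> equals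
  \<open>- z^(-i) (1 - z^i)\<close>; hence the explicit formula
  \<open>F_n(t) = \<Sum>k. q^(k^2) t^k [n-1-k choose k]\<close> turns \<open>F_n(q)\<close> into the sum over the coefficients
  \<open>[2k choose k]\<close>, and likewise \<open>F_(n+2)(1)\<close> into the sum over \<open>- q [2k choose k+1]\<close>. The constant 2
  consists of the term \<open>k = 0\<close> of \<open>F_(n+2)(1)\<close> and of the term \<open>k = n - 1\<close> of the second sum, whose
  coefficient \<open>[2n-2 choose n]\<close> is 1 by the q-Lucas theorem.
  For the closed form, Schur's finite Rogers-Ramanujan identities write \<open>F_n(q)\<close> and \<open>F_(n+2)(1)\<close> as
  alternating sums of \<open>[n choose j]\<close> and \<open>[n+1 choose j]\<close>, almost all of which vanish at \<open>z\<close>.\<close>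

section \<open>Gaussian coefficients\<close>

text \<open>The value of the Gaussian coefficient at \<open>q\<close>. Pascal's rule involves no
  division, so the definition makes sense at roots of unity; the integer lower index spares boundary
  cases in the recurrences.\<close>

fun gauss :: "'a::field \<Rightarrow> nat \<Rightarrow> int \<Rightarrow> 'a" where
  "gauss q 0 k = (if k = 0 then 1 else 0)"
| "gauss q (Suc m) k = gauss q m (k - 1) + q powi k * gauss q m k"

lemma gauss_eq_0: "k < 0 \<or> k > int m \<Longrightarrow> gauss q m k = 0"
  by (induction m arbitrary: k) auto

lemma gauss_0_right [simp]: "gauss q m 0 = 1"
  by (induction m) (auto simp: gauss_eq_0)

text \<open>This is the second Pascal rule. Applying the induction hypothesis to both terms of the
  first rule gives four terms, which regroup in pairs by the first rule.\<close>

lemma gauss_Suc_alt: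
  assumes "q \<noteq> 0"
  shows "gauss q (Suc m) k = gauss q m k + q powi (int m + 1 - k) * gauss q m (k - 1)"
proof (induction m arbitrary: k)
  case 0
  show ?case by auto
next
  case (Suc m)
  have "gauss q (Suc (Suc m)) k = gauss q (Suc m) (k - 1) + q powi k * gauss q (Suc m) k"
    by simp
  also have "\<dots> = gauss q m (k - 1) + q powi (int m + 2 - k) * gauss q m (k - 2)
      + q powi k * gauss q m k + q powi (int m + 1) * gauss q m (k - 1)"
    using assms by (simp only: Suc) (simp add: algebra_simps flip: power_int_add)
  also have "\<dots> = gauss q (Suc m) k + q powi (int (Suc m) + 1 - k) * gauss q (Suc m) (k - 1)"
    using assms by (simp add: algebra_simps flip: power_int_add)
  finally show ?case .
qed

text \<open>The product formula with its denominator cleared, so that it remains valid at roots of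
  unity. For \<open>k > m\<close> both sides vanish, the right one through the factor
  \<open>i = m\<close>.\<close>

lemma gauss_prod:
  assumes "q \<noteq> 0"
  shows "gauss q m (int k) * (\<Prod>i<k. 1 - q ^ Suc i) = (\<Prod>i<k. 1 - q powi (int m - int i))"
proof (induction m arbitrary: k)
  case 0
  show ?case
  proof (cases k)
    case (Suc j)
    have "(\<Prod>i<k. 1 - q powi (int 0 - int i)) = 0"
      using Suc by (intro prod_zero) (auto intro!: bexI[of _ 0])
    then show ?thesis using Suc by simp
  qed auto
next
  case (Suc m)
  show ?case
  proof (cases k)
    case (Suc j)
    let ?R = "\<Prod>i<j. 1 - q powi (int m - int i)"
    have shift: "(\<Prod>i<k. 1 - q powi (int (Suc m) - int i)) = (1 - q powi (int m + 1)) * ?R"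
      unfolding Suc prod.lessThan_Suc_shift by (simp add: algebra_simps)
    have last: "(\<Prod>i<k. 1 - q powi (int m - int i)) = ?R * (1 - q powi (int m - int j))"
      unfolding Suc by simp
    have "gauss q (Suc m) (int k) * (\<Prod>i<k. 1 - q ^ Suc i)
        = (1 - q ^ Suc j) * (gauss q m (int j) * (\<Prod>i<j. 1 - q ^ Suc i))
          + q ^ Suc j * (gauss q m (int k) * (\<Prod>i<k. 1 - q ^ Suc i))"
      using Suc by (simp add: algebra_simps power_int_add assms)
    also have "\<dots> = (1 - q ^ Suc j) * ?R + q ^ Suc j * (?R * (1 - q powi (int m - int j)))"
      by (simp only: Suc.IH last)
    also have "\<dots> = (1 - q powi (int m + 1)) * ?R"
    proof -
      have "q ^ Suc j * q powi (int m - int j) = q powi (int m + 1)"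
        using assms by (simp add: add.commute flip: power_int_of_nat power_int_add)
      moreover have "(1 - x) * r + x * (r * (1 - y)) = (1 - x * y) * r" for x y r :: 'a
        by (simp add: algebra_simps)
      ultimately show ?thesis by simp
    qed
    finally show ?thesis unfolding shift .
  qed auto
qed

section \<open>The q-Fibonacci numbers and the Schur identities\<close>

text \<open>Indexed with a shift: \<open>fibq q t m\<close> is \<open>F_(m+1)(t)\<close>.\<close>

definition fibq :: "'a::field \<Rightarrow> 'a \<Rightarrow> nat \<Rightarrow> 'a" where
  "fibq q t m = (\<Sum>k\<le>m. q ^ k\<^sup>2 * t ^ k * gauss q (m - k) (int k))"

lemma fibq_0 [simp]: "fibq q t 0 = 1"
  by (simp add: fibq_def)

lemma fibq_1 [simp]: "fibq q t (Suc 0) = 1"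
  by (simp add: fibq_def)

text \<open>The second Pascal rule splits each coefficient: \<open>a\<close> sums to
  \<open>fibq q t (Suc m)\<close>, and \<open>b\<close>, after an index shift, to the other term,
  because \<open>(k+1)^2 + m - 2k = m + 1 + k^2\<close>.\<close>

lemma fibq_rec:
  fixes q t :: "'a::field"
  assumes "q \<noteq> 0"
  shows "fibq q t (Suc (Suc m)) = fibq q t (Suc m) + q ^ Suc m * t * fibq q t m"
proof -
  define a where "a k = q ^ k\<^sup>2 * t ^ k * gauss q (Suc m - k) (int k)" for k
  define b where "b k = q ^ k\<^sup>2 * t ^ k * (q powi (int m + 2 - 2 * int k) * gauss q (Suc m - k) (int k - 1))" for k
  \<comment> \<open>The summand \<open>k = m + 2\<close> drops out: its coefficient lies in row 0
    and has a positive lower index.\<close>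
  have "fibq q t (Suc (Suc m)) = (\<Sum>k\<le>Suc m. q ^ k\<^sup>2 * t ^ k * gauss q (Suc (Suc m) - k) (int k))"
    unfolding fibq_def by (subst sum.atMost_Suc) simp
  also have "\<dots> = (\<Sum>k\<le>Suc m. a k + b k)"
  proof (rule sum.cong[OF refl])
    fix k assume "k \<in> {..Suc m}"
    then have "Suc (Suc m) - k = Suc (Suc m - k)" and "int (Suc m - k) + 1 - int k = int m + 2 - 2 * int k"
      by auto
    then show "q ^ k\<^sup>2 * t ^ k * gauss q (Suc (Suc m) - k) (int k) = a k + b k"
      using assms by (simp add: a_def b_def gauss_Suc_alt distrib_left add.commute del: gauss.simps)
  qed
  also have "\<dots> = fibq q t (Suc m) + (\<Sum>k\<le>Suc m. b k)"
    by (simp only: sum.distrib a_def fibq_def)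
  also have "(\<Sum>k\<le>Suc m. b k) = (\<Sum>k\<le>m. b (Suc k))"
    by (subst sum.atMost_Suc_shift) (simp add: b_def gauss_eq_0)
  also have "\<dots> = (\<Sum>k\<le>m. q ^ Suc m * t * (q ^ k\<^sup>2 * t ^ k * gauss q (m - k) (int k)))"
  proof (rule sum.cong[OF refl])
    fix k
    have "q ^ (Suc k)\<^sup>2 * q powi (int m - 2 * int k) = q ^ Suc m * q ^ k\<^sup>2"
      using assms by (simp add: power2_eq_square algebra_simps flip: power_int_of_nat power_int_add)
    then show "b (Suc k) = q ^ Suc m * t * (q ^ k\<^sup>2 * t ^ k * gauss q (m - k) (int k))"
      by (simp add: b_def mult_ac)
  qed
  also have "\<dots> = q ^ Suc m * t * fibq q t m"
    by (simp add: fibq_def sum_distrib_left)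
  finally show ?thesis .
qed

section \<open>Schur's finite Rogers-Ramanujan sums\<close>

text \<open>Terms of \<open>(-1)^l q^(l(5l+1-4c)/2) [m choose \<lfloor>(m-5l)/2\<rfloor> + c]\<close>: the case \<open>c = 0\<close> is Schur's
  formula for \<open>F_(m+1)(1)\<close>, and \<open>c = 1\<close> the one for \<open>F_m(q)\<close>.\<close>

definition schur_exp :: "int \<Rightarrow> int \<Rightarrow> int" where
  "schur_exp c l = l * (5 * l + 1 - 4 * c) div 2"

lemma schur_exp_double: "2 * schur_exp c l = l * (5 * l + 1 - 4 * c)"
proof -
  have "even (l * (5 * l + 1 - 4 * c))" by auto
  then show ?thesis by (simp add: schur_exp_def)
qed

definition schur_term :: "'a::field \<Rightarrow> int \<Rightarrow> nat \<Rightarrow> int \<Rightarrow> 'a" where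
  "schur_term q c m l = (-1) powi l * q powi schur_exp c l * gauss q m ((int m - 5 * l) div 2 + c)"

text \<open>The cut-off \<open>L\<close> does not depend on \<open>m\<close>, so that the three sums
  in the recurrence run over the same range and can be compared term by term.\<close>

definition schur_sum :: "'a::field \<Rightarrow> int \<Rightarrow> int \<Rightarrow> nat \<Rightarrow> 'a" where
  "schur_sum q L c m = (\<Sum>l\<in>{-L..L}. schur_term q c m l)"

text \<open>Applying the two Pascal rules leaves a remainder in the recurrence for each single term; the
  remainders at neighbouring \<open>l\<close> cancel in pairs, the pairing depending on the parity of \<open>m\<close>.\<close>

definition schur_rem :: "'a::field \<Rightarrow> int \<Rightarrow> nat \<Rightarrow> int \<Rightarrow> 'a" where
  "schur_rem q c m l = (if even (int m + l)
     then (-1) powi l * q powi (schur_exp c l + ((int m - 5 * l) div 2 + 1 + c)) *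
          gauss q m ((int m - 5 * l) div 2 + 1 + c)
     else 0)"

text \<open>The first Pascal rule is applied first if \<open>m + l\<close> is even, the second if it
  is odd. At most one of the two remainders is nonzero; their difference covers both parities and
  telescopes when summed.\<close>

lemma schur_term_rec:
  fixes q :: "'a::field"
  assumes q: "q \<noteq> 0"
  shows "schur_term q c (Suc (Suc m)) l =
     schur_term q c (Suc m) l + q ^ Suc m * schur_term q c m l
     + (schur_rem q c m l - schur_rem q c m (l + 1))"
proof (cases "even (int m + l)")
  case True
  then have "even (int m - 5 * l)" by simp
  then obtain k where k: "int m - 5 * l = 2 * k" by (elim evenE)
  define j where "j = k + c"
  have d: "(int (Suc (Suc m)) - 5 * l) div 2 + c = j + 1" "(int (Suc m) - 5 * l) div 2 + c = j"
    "(int m - 5 * l) div 2 + c = j" "(int m - 5 * l) div 2 + 1 + c = j + 1"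
    using k by (auto simp: j_def)
  have "gauss q (Suc (Suc m)) (j + 1) = gauss q (Suc m) j + q powi (j + 1) * gauss q (Suc m) (j + 1)"
    by simp
  also have "gauss q (Suc m) (j + 1) = gauss q m (j + 1) + q powi (int m - j) * gauss q m j"
    using gauss_Suc_alt[OF q, of m "j + 1"] by (simp add: algebra_simps)
  also have "q powi (j + 1) * (gauss q m (j + 1) + q powi (int m - j) * gauss q m j)
      = q powi (j + 1) * gauss q m (j + 1) + q ^ Suc m * gauss q m j"
  proof -
    have "q powi (j + 1) * q powi (int m - j) = q ^ Suc m"
      using q by (simp flip: power_int_of_nat power_int_add)
    then show ?thesis by (simp only: distrib_left flip: mult.assoc)
  qed
  finally have "gauss q (Suc (Suc m)) (j + 1)
      = gauss q (Suc m) j + q powi (j + 1) * gauss q m (j + 1) + q ^ Suc m * gauss q m j"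
    by (simp add: algebra_simps)
  moreover have "schur_rem q c m (l + 1) = 0"
    using True by (simp add: schur_rem_def)
  moreover have "schur_rem q c m l
      = (-1) powi l * q powi schur_exp c l * (q powi (j + 1) * gauss q m (j + 1))"
    using True q by (simp only: schur_rem_def d(4)) (simp add: power_int_add)
  ultimately show ?thesis
    unfolding schur_term_def d by (simp add: algebra_simps)
next
  case False
  then have "odd (int m - 5 * l)" by simp
  then obtain k where k: "int m - 5 * l = 2 * k + 1" by (elim oddE)
  define j where "j = k + c"
  have d: "(int (Suc (Suc m)) - 5 * l) div 2 + c = j + 1" "(int (Suc m) - 5 * l) div 2 + c = j + 1"
    "(int m - 5 * l) div 2 + c = j" "(int m - 5 * (l + 1)) div 2 + 1 + c = j - 1"
    using k by (auto simp: j_def)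
  \<comment> \<open>The quadratic exponent is made for this coincidence: the leftover term at an odd
    \<open>m + l\<close> is minus the remainder at \<open>l + 1\<close>.\<close>
  have e: "schur_exp c (l + 1) + (j - 1) = schur_exp c l + (int m + 1 - j)"
    using schur_exp_double[of c "l + 1"] schur_exp_double[of c l] k
    by (simp add: j_def algebra_simps)
  have "gauss q (Suc (Suc m)) (j + 1)
      = gauss q (Suc m) (j + 1) + q powi (int m + 1 - j) * gauss q (Suc m) j"
    using gauss_Suc_alt[OF q, of "Suc m" "j + 1"] by (simp add: algebra_simps del: gauss.simps)
  also have "q powi (int m + 1 - j) * gauss q (Suc m) j
      = q powi (int m + 1 - j) * gauss q m (j - 1) + q ^ Suc m * gauss q m j"
  proof -
    have "q powi (int m + 1 - j) * q powi j = q ^ Suc m"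
      using q by (simp add: add.commute del: power_Suc flip: power_int_of_nat power_int_add)
    then show ?thesis by (simp only: gauss.simps distrib_left flip: mult.assoc)
  qed
  finally have *: "gauss q (Suc (Suc m)) (j + 1) = gauss q (Suc m) (j + 1)
      + (q powi (int m + 1 - j) * gauss q m (j - 1) + q ^ Suc m * gauss q m j)" .
  have "schur_rem q c m l = 0"
    using False by (simp add: schur_rem_def)
  moreover have "schur_rem q c m (l + 1)
      = - ((-1) powi l * q powi schur_exp c l * (q powi (int m + 1 - j) * gauss q m (j - 1)))"
  proof -
    have "schur_rem q c m (l + 1)
        = (-1) powi (l + 1) * q powi (schur_exp c (l + 1) + (j - 1)) * gauss q m (j - 1)"
      using False by (simp only: schur_rem_def d(4)) simp
    also have "\<dots> = - ((-1) powi l * q powi schur_exp c l * (q powi (int m + 1 - j) * gauss q m (j - 1)))"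
      unfolding e using q by (simp add: power_int_add)
    finally show ?thesis .
  qed
  ultimately show ?thesis
    unfolding schur_term_def d * by (simp add: algebra_simps del: gauss.simps)
qed

lemma sum_telescope_int:
  fixes f :: "int \<Rightarrow> 'a::ab_group_add"
  assumes "a \<le> b + 1"
  shows "(\<Sum>l\<in>{a..b}. f l - f (l + 1)) = f a - f (b + 1)"
proof -
  have "(\<Sum>l\<in>{a..b}. f (l + 1)) = sum f {a + 1..b + 1}"
    by (rule sum.reindex_bij_witness[of _ "\<lambda>l. l - 1" "\<lambda>l. l + 1"]) auto
  moreover have "sum f {a..b + 1} = f a + sum f {a + 1..b + 1}"
  proof -
    have "{a..b + 1} = insert a {a + 1..b + 1}" using assms by auto
    then show ?thesis by simp
  qed
  moreover have "sum f {a..b + 1} = f (b + 1) + sum f {a..b}"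
  proof -
    have "{a..b + 1} = insert (b + 1) {a..b}" using assms by auto
    then show ?thesis by simp
  qed
  ultimately show ?thesis by (simp add: sum_subtractf algebra_simps)
qed

lemma schur_sum_rec:
  fixes q :: "'a::field"
  assumes q: "q \<noteq> 0" and c: "0 \<le> c" "c \<le> 1" and L: "int m \<le> L" "1 \<le> L"
  shows "schur_sum q L c (Suc (Suc m)) = schur_sum q L c (Suc m) + q ^ Suc m * schur_sum q L c m"
proof -
  \<comment> \<open>At both ends of the telescope the lower index falls outside the range from 0 to
    \<open>m\<close>, by the bounds on \<open>L\<close>.\<close>
  have "schur_rem q c m (- L) = 0" "schur_rem q c m (L + 1) = 0"
    unfolding schur_rem_def using c L by (auto intro!: gauss_eq_0)
  then have "(\<Sum>l\<in>{-L..L}. schur_rem q c m l - schur_rem q c m (l + 1)) = 0"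
    using L by (subst sum_telescope_int) auto
  then show ?thesis
    by (simp add: schur_sum_def schur_term_rec[OF q] sum.distrib sum_distrib_left)
qed

text \<open>In rows 0 and 1 only \<open>l = 0\<close> keeps the lower index in range. The
  exceptional value 0 corresponds to \<open>F_0(q) = 0\<close>.\<close>

lemma schur_sum_base:
  fixes q :: "'a::field"
  assumes "c \<in> {0, 1}" "m \<in> {0, 1}" "1 \<le> L"
  shows "schur_sum q L c m = (if c = 1 \<and> m = 0 then 0 else 1)"
proof -
  have z: "schur_term q c m l = 0" if "l \<noteq> 0" for l
  proof -
    have "(int m - 5 * l) div 2 + c < 0 \<or> (int m - 5 * l) div 2 + c > int m"
      using assms that by auto
    then show ?thesis by (simp add: schur_term_def gauss_eq_0)
  qed
  have "schur_sum q L c m = (\<Sum>l\<in>{0}. schur_term q c m l)"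
    unfolding schur_sum_def using assms z by (intro sum.mono_neutral_right) auto
  then show ?thesis
    using assms by (auto simp: schur_term_def schur_exp_def)
qed

text \<open>Both sides satisfy the same recurrence with the same initial values.\<close>

lemma fibq_1_eq_schur_sum:
  assumes "q \<noteq> 0" "int m \<le> L" "1 \<le> L"
  shows "fibq q 1 m = schur_sum q L 0 m"
  using assms(2)
proof (induction m rule: induct_nat_012)
  case (ge2 m)
  then show ?case
    using assms by (simp only: fibq_rec[OF assms(1)] schur_sum_rec) (simp add: schur_sum_rec)
qed (use assms in \<open>auto simp: schur_sum_base\<close>)

text \<open>With \<open>t = q\<close> the factor \<open>q^(m+1) t\<close> becomes
  \<open>q^(m+2)\<close>, which is the recurrence of the Schur sums one row later; hence
  \<open>Suc m\<close> on the right.\<close>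

lemma fibq_q_eq_schur_sum:
  assumes "q \<noteq> 0" "int m < L" "1 \<le> L"
  shows "fibq q q m = schur_sum q L 1 (Suc m)"
  using assms(2)
proof (induction m rule: induct_nat_012)
  case (ge2 m)
  then show ?case
    using assms by (simp only: fibq_rec[OF assms(1)]) (simp add: schur_sum_rec)
next
  case 1
  then show ?case
    using assms by (simp add: schur_sum_rec schur_sum_base)
qed (use assms in \<open>auto simp: schur_sum_base\<close>)

section \<open>Evaluation at primitive roots of unity\<close>

definition primitive_root :: "nat \<Rightarrow> 'a::field \<Rightarrow> bool" where
  "primitive_root n z \<longleftrightarrow> z ^ n = 1 \<and> (\<forall>k. 0 < k \<and> k < n \<longrightarrow> z ^ k \<noteq> 1)"

lemma primitive_root_nonzero: "primitive_root n z \<Longrightarrow> n > 0 \<Longrightarrow> z \<noteq> 0"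
  by (auto simp: primitive_root_def power_0_left)

lemma primitive_root_powi:
  assumes "primitive_root n z" "n > 0"
  shows "z powi (int n + k) = z powi k"
  using assms primitive_root_nonzero[OF assms] by (simp add: power_int_add primitive_root_def)

lemma primitive_root_prod_neq_0:
  assumes "primitive_root n z" "k < n"
  shows "(\<Prod>i<k. 1 - z ^ Suc i) \<noteq> 0"
proof -
  have "z ^ Suc i \<noteq> 1" if "i < k" for i
    using assms that unfolding primitive_root_def by (metis Suc_lessI less_trans zero_less_Suc)
  then show ?thesis by (simp add: eq_commute[of 1])
qed

text \<open>The case of the q-Lucas theorem with one full block of length \<open>n\<close>. Row
  \<open>n\<close> has only its two end coefficients, and Pascal's rule carries this on to later
  rows because \<open>z^k\<close> depends only on \<open>k\<close> modulo \<open>n\<close>.\<close>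

lemma gauss_root_lucas:
  assumes z: "primitive_root n z" "n > 0"
  shows "gauss z (n + a) k = gauss z a k + gauss z a (k - int n)"
proof (induction a arbitrary: k)
  case 0
  consider "k < 0 \<or> k > int n" | "k = 0" | "k = int n" | "0 < k" "k < int n" by linarith
  then show ?case
  proof cases
    case 3
    have "gauss z m (int m) = 1" for m
      by (induction m) (auto simp: gauss_eq_0)
    then show ?thesis using 3 z by simp
  next
    case 4
    define j where "j = nat k"
    have j: "k = int j" "0 < j" "j < n" using 4 by (auto simp: j_def)
    \<comment> \<open>The factor \<open>i = 0\<close> is \<open>1 - z^n\<close>, while the
      denominator is nonzero for \<open>j < n\<close>.\<close>
    have "(\<Prod>i<j. 1 - z powi (int n - int i)) = 0"
      using j z by (intro prod_zero) (auto simp: primitive_root_def intro!: bexI[of _ 0])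
    then have "gauss z n (int j) * (\<Prod>i<j. 1 - z ^ Suc i) = 0"
      by (simp only: gauss_prod[OF primitive_root_nonzero[OF z]])
    then have "gauss z n k = 0"
      using primitive_root_prod_neq_0[OF z(1) j(3)] j(1) by simp
    then show ?thesis using 4 by simp
  qed (use z in \<open>auto simp: gauss_eq_0\<close>)
next
  case (Suc a)
  have "z powi k = z powi (k - int n)"
    using primitive_root_powi[OF z, of "k - int n"] by simp
  then show ?case
    by (simp only: add_Suc_right gauss.simps Suc) (simp add: algebra_simps)
qed

lemma two_choose_two: "2 * int (k choose 2) = int k * (int k - 1)"
  by (induction k) (auto simp: numeral_2_eq_2 algebra_simps)

text \<open>The hypothesis says \<open>b - (k - 1 - i) \<equiv> - (a - i)\<close> modulo \<open>n\<close>, so the numerators of the two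
  product formulas agree up to the factors \<open>- z powi (a - i)\<close>.\<close>

lemma gauss_root_reflect:
  assumes z: "primitive_root n z" "n > 0" and k: "k < n"
    and s: "int a + int b + 1 = int n + int k"
  shows "gauss z a (int k) = (-1) ^ k * z powi (int k * int a - int (k choose 2)) * gauss z b (int k)"
proof -
  have z0: "z \<noteq> 0" using primitive_root_nonzero[OF z] .
  let ?e = "\<lambda>i. int a - int i"
  have "(\<Prod>i<k. 1 - z powi ?e i) = (\<Prod>i<k. - (z powi ?e i) * (1 - z powi (- ?e i)))"
    using z0 by (intro prod.cong) (auto simp: algebra_simps simp flip: power_int_add)
  also have "\<dots> = (\<Prod>i<k. - (z powi ?e i)) * (\<Prod>i<k. 1 - z powi (- ?e i))"
    by (rule prod.distrib)
  also have "(\<Prod>i<k. 1 - z powi (- ?e i)) = (\<Prod>i<k. 1 - z powi (int b - int i))"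
  proof (rule prod.reindex_bij_witness[of _ "\<lambda>i. k - 1 - i" "\<lambda>i. k - 1 - i"])
    fix i assume "i \<in> {..<k}"
    then have "int b - int (k - 1 - i) = int n + (- ?e i)" using s by auto
    then show "1 - z powi (int b - int (k - 1 - i)) = 1 - z powi (- ?e i)"
      using primitive_root_powi[OF z, of "- ?e i"] by simp
  qed auto
  also have "(\<Prod>i<k. - (z powi ?e i)) = (-1) ^ k * z powi (int k * int a - int (k choose 2))"
  proof (induction k)
    case (Suc k)
    have "int (Suc k choose 2) = int k + int (k choose 2)" by (simp add: numeral_2_eq_2)
    then show ?case using Suc z0 by (simp add: algebra_simps power_int_add power_int_diff)
  qed (simp add: numeral_2_eq_2)
  finally have "gauss z a (int k) * (\<Prod>i<k. 1 - z ^ Suc i)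
      = (-1) ^ k * z powi (int k * int a - int (k choose 2)) * gauss z b (int k) * (\<Prod>i<k. 1 - z ^ Suc i)"
    by (simp only: mult.assoc gauss_prod[OF z0])
  then show ?thesis using primitive_root_prod_neq_0[OF z(1) k] by simp
qed

text \<open>Reflection with upper indices \<open>n - 1 - k\<close> and \<open>2k\<close>. In the
  exponent, \<open>k^2 + k\<close> and \<open>k(n - 1 - k)\<close> add up to \<open>nk\<close>,
  which contributes the factor 1.\<close>

lemma fibq_q_root:
  assumes z: "primitive_root n z" "n > 0"
  shows "fibq z z (n - 1) = (\<Sum>k<n. (-1) ^ k * z powi (- int (k choose 2)) * gauss z (2 * k) (int k))"
proof -
  have z0: "z \<noteq> 0" using primitive_root_nonzero[OF z] .
  have *: "z ^ k\<^sup>2 * z ^ k * gauss z (n - 1 - k) (int k)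
      = (-1) ^ k * z powi (- int (k choose 2)) * gauss z (2 * k) (int k)" if k: "k < n" for k
  proof -
    let ?a = "n - 1 - k"
    have a: "int ?a = int n - 1 - int k" using k by auto
    have reflect: "gauss z ?a (int k) = (-1) ^ k * z powi (int k * int ?a - int (k choose 2)) * gauss z (2 * k) (int k)"
      using k by (intro gauss_root_reflect[OF z]) auto
    have "z ^ k\<^sup>2 * z ^ k * z powi (int k * int ?a - int (k choose 2))
        = z powi (int n * int k + - int (k choose 2))"
      unfolding a using z0
      by (simp add: power2_eq_square algebra_simps flip: power_int_of_nat power_int_add)
    also have "\<dots> = z powi (int n * int k) * z powi (- int (k choose 2))"
      using z0 by (intro power_int_add) simp
    also have "z powi (int n * int k) = 1"
      using z by (simp add: power_int_mult primitive_root_def)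
    finally have e: "z powi (- int (k choose 2))
        = z ^ k\<^sup>2 * z ^ k * z powi (int k * int ?a - int (k choose 2))"
      by simp
    show ?thesis unfolding reflect e by (simp only: mult_ac)
  qed
  show ?thesis
    unfolding fibq_def
  proof (rule sum.cong)
    show "{..n - 1} = {..<n}" using z(2) by auto
  qed (rule *, simp)
qed

lemma fibq_1_root:
  assumes z: "primitive_root n z" "n > 0"
  shows "fibq z 1 (n + 1) = 2 -
    (\<Sum>k<n. (-1) ^ k * z powi (1 - int (k choose 2)) * gauss z (2 * k) (int (k + 1)))"
\<comment> \<open>For \<open>n = 1\<close> the last coefficient \<open>gauss z 0 1\<close> is 0
  instead of 1; this is balanced by the term \<open>k = 1\<close> of \<open>fibq z 1 2\<close>,
  which equals 1.\<close>
proof (cases "n = 1")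
  case True
  then show ?thesis using z by (simp add: fibq_rec primitive_root_def gauss_eq_0)
next
  case False
  define t where "t k = (-1) ^ k * z powi (1 - int (k choose 2)) * gauss z (2 * k) (int (k + 1))" for k
  obtain m where n: "n = Suc (Suc m)" using False z(2) by (metis One_nat_def not0_implies_Suc not_gr0)
  have z0: "z \<noteq> 0" using primitive_root_nonzero[OF z] .
  have *: "z ^ (Suc k)\<^sup>2 * gauss z (n + 1 - Suc k) (int (Suc k)) = - t k" if k: "Suc k < n" for k
  proof -
    let ?a = "n + 1 - Suc k"
    have a: "int ?a = int n - int k" using k by auto
    have "gauss z ?a (int (Suc k)) = (-1) ^ Suc k * z powi (int (Suc k) * int ?a - int (Suc k choose 2))
        * gauss z (2 * k) (int (Suc k))"
      using k by (intro gauss_root_reflect[OF z]) auto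
    \<comment> \<open>Reflection here pairs the upper indices \<open>n - k\<close> and
      \<open>2k\<close> at lower index \<open>k + 1\<close>; up to a multiple of \<open>n\<close>
      the total exponent is \<open>1 - (k choose 2)\<close>.\<close>
    moreover have "z ^ (Suc k)\<^sup>2 * z powi (int (Suc k) * int ?a - int (Suc k choose 2))
        = z powi (int n * int (Suc k) + (1 - int (k choose 2)))"
    proof -
      have "int ((Suc k)\<^sup>2) + (int (Suc k) * int ?a - int (Suc k choose 2))
          = int n * int (Suc k) + (1 - int (k choose 2))"
        unfolding a by (simp add: numeral_2_eq_2 algebra_simps)
      then show ?thesis using z0 by (metis power_int_add power_int_of_nat)
    qed
    moreover have "z powi (int n * int (Suc k)) = 1"
      using z unfolding power_int_mult by (simp add: primitive_root_def)
    ultimately show ?thesis using z0 by (simp add: t_def power_int_add del: gauss.simps)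
  qed
  have last: "t (Suc m) = 1"
  proof -
    have "2 * Suc m = n + m" "Suc m + 1 = n" by (simp_all add: n)
    then have "gauss z (2 * Suc m) (int (Suc m + 1)) = gauss z (n + m) (int n)"
      by (simp only:)
    also have "\<dots> = 1" by (simp only: gauss_root_lucas[OF z]) (simp add: gauss_eq_0 n)
    finally have "t (Suc m) = (-1) ^ Suc m * z powi (1 - int (Suc m choose 2))"
      by (simp add: t_def del: gauss.simps)
    \<comment> \<open>The exponent is \<open>- n(n - 3)/2\<close>. For odd \<open>n\<close> it is a
      multiple of \<open>n\<close>; for even \<open>n\<close> it is an odd multiple of
      \<open>n/2\<close>, and \<open>z^(n/2) = -1\<close> cancels the sign.\<close>
    also have "\<dots> = 1"
    proof (cases "even m")
      case True
      then obtain p where p: "m = 2 * p" by (elim evenE)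
      have "n = Suc p * 2" using n p by simp
      then have "(z ^ Suc p)\<^sup>2 = 1"
        using z(1) by (simp only: primitive_root_def power_mult)
      moreover have "z ^ Suc p \<noteq> 1"
        using z(1) n p by (simp add: primitive_root_def del: power_Suc)
      ultimately have half: "z powi (int (Suc p)) = -1"
        unfolding power_int_of_nat by (simp add: power2_eq_1_iff del: power_Suc)
      have "1 - int (Suc m choose 2) = int (Suc p) * (1 - 2 * int p)"
        using two_choose_two[of "Suc m"] p by (simp add: algebra_simps)
      then have "z powi (1 - int (Suc m choose 2)) = (-1) powi (1 - 2 * int p)"
        by (simp only: power_int_mult half)
      also have "\<dots> = -1" by (simp add: power_int_diff power_int_mult)
      finally show ?thesis using True by simp
    next
      case False
      then obtain p where p: "m = 2 * p + 1" by (elim oddE)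
      have "1 - int (Suc m choose 2) = int n * (- int p)"
        using two_choose_two[of "Suc m"] p n by (simp add: algebra_simps)
      then have "z powi (1 - int (Suc m choose 2)) = 1"
        using z by (simp only: power_int_mult) (simp add: primitive_root_def)
      then show ?thesis using False by simp
    qed
    finally show ?thesis .
  qed
  have "fibq z 1 (n + 1) = (\<Sum>k\<le>Suc n. z ^ k\<^sup>2 * gauss z (n + 1 - k) (int k))"
    by (simp add: fibq_def del: gauss.simps sum.atMost_Suc)
  also have "\<dots> = 1 + (\<Sum>k\<le>n. z ^ (Suc k)\<^sup>2 * gauss z (n + 1 - Suc k) (int (Suc k)))"
    by (subst sum.atMost_Suc_shift) (simp del: gauss.simps)
  \<comment> \<open>The two top terms vanish: their coefficients lie in rows 1 and 0, with lower
    indices \<open>n >= 2\<close> and \<open>n + 1\<close>.\<close>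
  also have "(\<Sum>k\<le>n. z ^ (Suc k)\<^sup>2 * gauss z (n + 1 - Suc k) (int (Suc k)))
      = (\<Sum>k\<in>{..<Suc m}. z ^ (Suc k)\<^sup>2 * gauss z (n + 1 - Suc k) (int (Suc k)))"
    unfolding n by (intro sum.mono_neutral_right) (auto intro!: gauss_eq_0)
  also have "\<dots> = - (\<Sum>k<Suc m. t k)"
    unfolding sum_negf[symmetric]
  proof (rule sum.cong)
    fix k assume "k \<in> {..<Suc m}"
    then have "Suc k < n" by (simp add: n)
    then show "z ^ (Suc k)\<^sup>2 * gauss z (n + 1 - Suc k) (int (Suc k)) = - t k" by (rule *)
  qed simp
  also have "1 + - (\<Sum>k<Suc m. t k) = 2 - (\<Sum>k<n. t k)"
    by (simp add: n last)
  finally show ?thesis by (simp only: t_def)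
qed

section \<open>The closed form at a primitive root of unity\<close>

definition schur_weight :: "'a::field \<Rightarrow> int \<Rightarrow> int \<Rightarrow> 'a" where
  "schur_weight q c l = (-1) powi l * q powi schur_exp c l"

lemma gauss_root:
  assumes "primitive_root n z" "n > 0"
  shows "gauss z n k = of_bool (k = 0) + of_bool (k = int n)"
  using gauss_root_lucas[OF assms, of 0 k] by simp

text \<open>The two indicators are added because they overlap for \<open>n = 1\<close>, where the
  middle coefficient of row 2 is 2.\<close>

lemma gauss_root_Suc:
  assumes "primitive_root n z" "n > 0"
  shows "gauss z (Suc n) k = of_bool (k = 0 \<or> k = 1) + of_bool (k = int n \<or> k = int n + 1)"
proof -
  have "gauss z 1 k = of_bool (k = 0 \<or> k = 1)" for k by auto
  then show ?thesis using gauss_root_lucas[OF assms, of 1 k] by (auto simp del: gauss.simps)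
qed

text \<open>At a primitive root of unity the coefficients vanish away from the two ends, so that at most
  one index \<open>l\<close> survives near each end.\<close>

lemma schur_sum_windows:
  fixes z :: "'a::field"
  assumes "\<And>l. gauss z m ((int m - 5 * l) div 2 + c) = of_bool (l = a \<and> P) + of_bool (l = b \<and> Q)"
    and "\<bar>a\<bar> \<le> L" "\<bar>b\<bar> \<le> L"
  shows "schur_sum z L c m = of_bool P * schur_weight z c a + of_bool Q * schur_weight z c b"
proof -
  \<comment> \<open>Two separate conditionals, since \<open>a = b\<close> is allowed; it occurs
    below when \<open>r = 0\<close>.\<close>
  have "schur_term z c m l = (if l = a then of_bool P * schur_weight z c a else 0)
      + (if l = b then of_bool Q * schur_weight z c b else 0)" for l
    by (simp add: schur_term_def schur_weight_def assms(1) distrib_left)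
  then show ?thesis
    using assms(2,3) by (simp add: schur_sum_def sum.distrib abs_le_iff)
qed

lemma div_2_eq_iff: "x div 2 = k \<longleftrightarrow> 2 * k \<le> x \<and> x \<le> 2 * k + 1" for x k :: int
  by linarith

text \<open>The lower index is 0 iff \<open>5(r - l) + s\<close> is -2 or -1, and \<open>n\<close>
  iff \<open>5(r + l) + s\<close> is 1 or 2. Since \<open>s\<close> is at most 2 in absolute value,
  this forces \<open>l = r\<close> or \<open>l = - r\<close>.\<close>

lemma schur_sum_1_root:
  assumes z: "primitive_root n z" "n > 0"
    and n: "int n = 5 * r + s" "\<bar>s\<bar> \<le> 2" and L: "int n \<le> L"
  shows "schur_sum z L 1 n = of_bool (s < 0) * schur_weight z 1 r + of_bool (s > 0) * schur_weight z 1 (- r)"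
proof (rule schur_sum_windows)
  fix l
  have "(int n - 5 * l) div 2 = - 1 \<longleftrightarrow> l = r \<and> s < 0"
    unfolding div_2_eq_iff using n by (cases l r rule: linorder_cases) auto
  moreover have "(int n - 5 * l) div 2 = int n - 1 \<longleftrightarrow> l = - r \<and> s > 0"
    unfolding div_2_eq_iff using n by (cases l "- r" rule: linorder_cases) auto
  ultimately show "gauss z n ((int n - 5 * l) div 2 + 1) = of_bool (l = r \<and> s < 0) + of_bool (l = - r \<and> s > 0)"
    by (simp add: gauss_root[OF z] eq_diff_eq eq_neg_iff_add_eq_0)
qed (use n L z(2) in auto)

text \<open>Each end of row \<open>n + 1\<close> has two nonzero coefficients, so the windows are
  wider: \<open>5(r - l) + s\<close> from -1 to 2, and \<open>5(r + l) + s\<close> from -2 to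
  1.\<close>

lemma schur_sum_0_root:
  assumes z: "primitive_root n z" "n > 0"
    and n: "int n = 5 * r + s" "\<bar>s\<bar> \<le> 2" and L: "int n \<le> L"
  shows "schur_sum z L 0 (Suc n) = of_bool (s > - 2) * schur_weight z 0 r + of_bool (s < 2) * schur_weight z 0 (- r)"
proof (rule schur_sum_windows)
  fix l
  let ?k = "(int (Suc n) - 5 * l) div 2 + 0"
  have "?k = 0 \<or> ?k = 1 \<longleftrightarrow> l = r \<and> s > - 2"
    unfolding add_0_right div_2_eq_iff using n by (cases l r rule: linorder_cases) auto
  moreover have "?k = int n \<or> ?k = int n + 1 \<longleftrightarrow> l = - r \<and> s < 2"
    unfolding add_0_right div_2_eq_iff using n by (cases l "- r" rule: linorder_cases) auto
  ultimately show "gauss z (Suc n) ?k = of_bool (l = r \<and> s > - 2) + of_bool (l = - r \<and> s < 2)"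
    by (simp only: gauss_root_Suc[OF z])
qed (use n L z(2) in auto)

lemma fibq_root_sum:
  assumes z: "primitive_root n z" "n > 0" and n: "int n = 5 * int r + s" "\<bar>s\<bar> \<le> 2"
  shows "fibq z z (n - 1) + fibq z 1 (n + 1) = (-1) ^ r *
    (of_bool (s < 0) * z powi (int r * (5 * int r - 3) div 2)
     + of_bool (s > 0) * z powi (int r * (5 * int r + 3) div 2)
     + of_bool (s > - 2) * z powi (int r * (5 * int r + 1) div 2)
     + of_bool (s < 2) * z powi (int r * (5 * int r - 1) div 2))"
proof -
  define L where "L = int n + 1"
  have z0: "z \<noteq> 0" using primitive_root_nonzero[OF z] .
  have L: "int n \<le> L" by (simp add: L_def)
  have "fibq z z (n - 1) = schur_sum z L 1 n"
    using fibq_q_eq_schur_sum[OF z0, of "n - 1" L] z(2) by (simp add: L_def)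
  moreover have "fibq z 1 (n + 1) = schur_sum z L 0 (Suc n)"
    using fibq_1_eq_schur_sum[OF z0, of "n + 1" L] by (simp add: L_def)
  moreover have "(-1 :: 'a) powi (- int r) = (-1) ^ r"
    by (cases "even r") (simp_all add: power_int_minus)
  moreover have "schur_exp 1 (int r) = int r * (5 * int r - 3) div 2"
    "schur_exp 1 (- int r) = int r * (5 * int r + 3) div 2"
    "schur_exp 0 (int r) = int r * (5 * int r + 1) div 2"
    "schur_exp 0 (- int r) = int r * (5 * int r - 1) div 2"
    by (simp_all add: schur_exp_def algebra_simps)
  ultimately show ?thesis
    using schur_sum_1_root[OF z n L] schur_sum_0_root[OF z n L]
    by (simp add: schur_weight_def distrib_left mult_ac)
qed

text \<open>\<open>rnd5 n\<close> is the integer nearest to \<open>n/5\<close>, so \<open>s\<close>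
  is the residue of \<open>n\<close> modulo 5 of least absolute value. It decides which powers
  survive, and \<open>5r = n - s\<close> gives their exponents the stated form.\<close>

lemma fibq_root_sum_cases:
  assumes z: "primitive_root n z" "n > 0"
  shows "fibq z z (n - 1) + fibq z 1 (n + 1) =
     (if n mod 5 \<in> {0, 2, 3}
      then (-1) ^ rnd5 n * (z powi ((int (rnd5 n) * (int n - 1)) div 2)
                          + z powi ((int (rnd5 n) * (int n + 1)) div 2))
      else (-1) ^ rnd5 n * (z powi ((int (rnd5 n) * (int n - 2)) div 2)
                          + z powi ((int (rnd5 n) * int n) div 2)
                          + z powi ((int (rnd5 n) * (int n + 2)) div 2)))"
proof -
  define r where "r = rnd5 n"
  define s where "s = int n - 5 * int r"
  have "\<bar>int n - 5 * int ((2 * n + 5) div 10)\<bar> \<le> 2" by presburger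
  then have n: "int n = 5 * int r + s" "\<bar>s\<bar> \<le> 2"
    unfolding s_def r_def rnd5_altdef by simp_all
  have "int (n mod 5) = s mod 5"
    using n(1) by (simp add: zmod_int)
  then have "n mod 5 = nat (s mod 5)" by linarith
  moreover have "s = 0 \<or> s = 1 \<or> s = -1 \<or> s = 2 \<or> s = -2" using n(2) by linarith
  ultimately consider "s = 0" "n mod 5 = 0" | "s = 1" "n mod 5 = 1" | "s = -1" "n mod 5 = 4"
    | "s = 2" "n mod 5 = 2" | "s = -2" "n mod 5 = 3"
    by (elim disjE) auto
  then show ?thesis
    unfolding fibq_root_sum[OF z n] r_def[symmetric] n(1)
    by cases (simp_all add: algebra_simps)
qed

section \<open>Congruences modulo cyclotomic polynomials\<close>

lemma primitive_root_cis:
  assumes "n > 0" "gcd m n = 1"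
  shows "primitive_root n (cis (2 * pi * real m / real n))"
  unfolding primitive_root_def
proof (intro conjI allI impI)
  show "cis (2 * pi * real m / real n) ^ n = 1"
    using assms cis_multiple_2pi[of "real m"] by (simp add: DeMoivre)
next
  fix k assume k: "0 < k \<and> k < n"
  show "cis (2 * pi * real m / real n) ^ k \<noteq> 1"
  proof
    assume "cis (2 * pi * real m / real n) ^ k = 1"
    then obtain i where "real k * (2 * pi * real m / real n) = of_int i * (2 * pi)"
      by (auto simp: DeMoivre cis_eq_1_iff)
    then have "real k * real m = of_int i * real n"
      using assms(1) by (simp add: field_simps)
    then have "of_int (int k * int m) = (of_int (i * int n) :: real)" by simp
    then have "int k * int m = i * int n" by (simp only: of_int_eq_iff)
    then have "int n dvd int (k * m)" by simp
    then have "n dvd k * m" by (simp only: of_nat_dvd_iff)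
    then have "n dvd k"
      using assms(2) by (simp add: coprime_dvd_mult_left_iff coprime_iff_gcd_eq_1 gcd.commute)
    then show False using k by (auto dest: dvd_imp_le)
  qed
qed

text \<open>Since the cyclotomic polynomial is monic, pseudo-division is division with remainder
  over the integers. The remainder vanishes at as many distinct points as the degree of the divisor,
  hence is 0.\<close>

lemma cyclotomic_dvd:
  assumes n: "n > 0"
    and root: "\<And>z :: complex. primitive_root n z \<Longrightarrow> poly (map_poly of_int P) z = 0"
  shows "cyclotomic n dvd P"
proof -
  let ?h = "map_poly (of_int :: int \<Rightarrow> complex)"
  let ?M = "{m. m < n \<and> gcd m n = 1}"
  let ?c = "\<lambda>m. cis (2 * pi * real m / real n)"
  have lc: "lead_coeff (cyclotomic n) = 1"
    using lead_coeff_cyclotomic_complex[of n]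
    by (simp add: degree_of_int_poly coeff_map_poly flip: of_int_poly_cyclotomic[OF n])
  then have nz: "cyclotomic n \<noteq> 0" by auto
  have deg: "degree (cyclotomic n) = card ?M"
  proof -
    have "degree (cyclotomic n) = degree (cyclotomic_complex n)"
      by (simp add: degree_of_int_poly flip: of_int_poly_cyclotomic[OF n])
    also have "\<dots> = card ?M"
      unfolding cyclotomic_complex_altdef by (subst degree_prod_eq_sum_degree) auto
    finally show ?thesis .
  qed
  obtain c r where cr: "pseudo_divmod P (cyclotomic n) = (c, r)" by fastforce
  then have P: "P = cyclotomic n * c + r" and r: "r = 0 \<or> degree r < degree (cyclotomic n)"
    using pseudo_divmod[OF nz cr] lc by simp_all
  have "r = 0"
  proof (rule ccontr)
    assume r0: "r \<noteq> 0"
    have "poly (?h r) (?c m) = 0" if m: "m \<in> ?M" for m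
    proof -
      have "poly (cyclotomic_complex n) (?c m) = 0"
        using m by (auto simp: cyclotomic_complex_altdef poly_prod intro!: prod_zero bexI[of _ m])
      moreover have "poly (?h P) (?c m) = 0"
        using m n by (intro root primitive_root_cis) auto
      ultimately show ?thesis
        by (simp add: P of_int_poly_add of_int_poly_mult of_int_poly_cyclotomic[OF n])
    qed
    moreover have "inj_on ?c ?M"
      using bij_betw_roots_unity[OF n] by (auto simp: bij_betw_def intro: inj_on_subset)
    ultimately have "card ?M \<le> card {z. poly (?h r) z = 0}"
      using r0 of_int_poly_inject[of r 0]
      by (intro card_inj_on_le[of ?c] poly_roots_finite) auto
    also have "\<dots> \<le> degree r"
      using r0 of_int_poly_inject[of r 0] card_poly_roots_bound[of "?h r"] by (auto simp: degree_of_int_poly)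
    finally show False using r r0 deg by simp
  qed
  then show ?thesis using P by simp
qed

section \<open>Evaluating Laurent polynomials\<close>

text \<open>\<open>f\<close> is the function induced by \<open>d\<close> on the nonzero complex numbers. A relation is used because it
  is closed under the ring operations without first constructing the evaluation homomorphism.\<close>

definition laurent_repr :: "laurent \<Rightarrow> (complex \<Rightarrow> complex) \<Rightarrow> bool" where
  "laurent_repr d f \<longleftrightarrow> (\<exists>P N. d * qpow (int N) = laurent_of_poly P \<and>
     (\<forall>z. z \<noteq> 0 \<longrightarrow> f z * z ^ N = poly (map_poly of_int P) z))"

lemma laurent_repr_poly: "laurent_repr (laurent_of_poly P) (\<lambda>z. poly (map_poly of_int P) z)"
  unfolding laurent_repr_def by (intro exI[of _ P] exI[of _ 0]) (simp add: qpow_0)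

lemma of_int_poly_qvar_power:
  "poly (map_poly of_int (qvar ^ n)) (z :: 'a::comm_ring_1) = z ^ n"
  by (induction n) (simp_all add: of_int_poly_mult map_poly_pCons del: mult_pCons_left)

lemma laurent_repr_qpow: "laurent_repr (qpow e) (\<lambda>z. z powi e)"
  unfolding laurent_repr_def
proof (intro exI conjI allI impI)
  \<comment> \<open>Multiplication by \<open>q^N\<close> with \<open>N = nat (- e)\<close> clears a
    negative exponent and is trivial for \<open>e >= 0\<close>.\<close>
  show "qpow e * qpow (int (nat (- e))) = laurent_of_poly (qvar ^ nat (e + int (nat (- e))))"
    by (simp add: laurent_of_poly_qvar_power flip: qpow_add)
  fix z :: complex assume "z \<noteq> 0"
  then show "z powi e * z ^ nat (- e) = poly (map_poly of_int (qvar ^ nat (e + int (nat (- e))))) z"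
    unfolding of_int_poly_qvar_power by (simp flip: power_int_of_nat power_int_add)
qed

lemma laurent_repr_mult:
  assumes "laurent_repr a f" "laurent_repr b g"
  shows "laurent_repr (a * b) (\<lambda>z. f z * g z)"
proof -
  from assms obtain P M R N where
    P: "a * qpow (int M) = laurent_of_poly P" "\<And>z. z \<noteq> 0 \<Longrightarrow> f z * z ^ M = poly (map_poly of_int P) z"
    and R: "b * qpow (int N) = laurent_of_poly R" "\<And>z. z \<noteq> 0 \<Longrightarrow> g z * z ^ N = poly (map_poly of_int R) z"
    unfolding laurent_repr_def by metis
  show ?thesis
    unfolding laurent_repr_def
    by (intro exI[of _ "P * R"] exI[of _ "M + N"])
      (simp add: qpow_add laurent_of_poly_mult of_int_poly_mult power_add mult_ac flip: P R)
qed

lemma laurent_repr_add: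
  assumes "laurent_repr a f" "laurent_repr b g"
  shows "laurent_repr (a + b) (\<lambda>z. f z + g z)"
proof -
  from assms obtain P M R N where
    P: "a * qpow (int M) = laurent_of_poly P" "\<And>z. z \<noteq> 0 \<Longrightarrow> f z * z ^ M = poly (map_poly of_int P) z"
    and R: "b * qpow (int N) = laurent_of_poly R" "\<And>z. z \<noteq> 0 \<Longrightarrow> g z * z ^ N = poly (map_poly of_int R) z"
    unfolding laurent_repr_def by metis
  show ?thesis
    unfolding laurent_repr_def
    \<comment> \<open>Both summands are brought to the common denominator
      \<open>q^(M+N)\<close>.\<close>
    by (intro exI[of _ "P * qvar ^ N + R * qvar ^ M"] exI[of _ "M + N"])
      (simp add: qpow_add laurent_of_poly_add laurent_of_poly_mult laurent_of_poly_qvar_power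
        of_int_poly_add of_int_poly_mult of_int_poly_qvar_power power_add algebra_simps flip: P R)
qed

lemma laurent_repr_uminus_1: "laurent_repr (- 1) (\<lambda>z. - 1)"
  unfolding laurent_repr_def
proof (intro exI[of _ "- 1"] exI[of _ 0] conjI allI impI)
  have "laurent_of_poly (- 1) + 1 = 0"
    using laurent_of_poly_add[of "- 1" 1] by (simp add: laurent_of_poly_1) (simp add: laurent_of_poly_def)
  then have "laurent_of_poly (- 1) = - 1"
    by (simp only: eq_neg_iff_add_eq_0)
  then show "- 1 * qpow (int 0) = laurent_of_poly (- 1)"
    by (simp add: qpow_0)
next
  show "- 1 * z ^ 0 = poly (map_poly of_int (- 1)) z" for z :: complex
  proof -
    have "- 1 = [:- 1 :: int:]" by (simp add: one_pCons)
    then show ?thesis by (simp add: map_poly_pCons)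
  qed
qed

lemma laurent_repr_0: "laurent_repr 0 (\<lambda>z. 0)"
  unfolding laurent_repr_def by (intro exI[of _ 0]) (simp add: laurent_of_poly_def)

lemma laurent_repr_1: "laurent_repr 1 (\<lambda>z. 1)"
  unfolding laurent_repr_def by (intro exI[of _ 1] exI[of _ 0]) (simp add: qpow_0 laurent_of_poly_1)

lemma laurent_repr_power: "laurent_repr a f \<Longrightarrow> laurent_repr (a ^ k) (\<lambda>z. f z ^ k)"
  by (induction k) (simp_all add: laurent_repr_1 laurent_repr_mult)

lemma laurent_repr_sum:
  "(\<And>x. x \<in> A \<Longrightarrow> laurent_repr (a x) (f x)) \<Longrightarrow> laurent_repr (\<Sum>x\<in>A. a x) (\<lambda>z. \<Sum>x\<in>A. f x z)"
  by (induction A rule: infinite_finite_induct) (simp_all add: laurent_repr_0 laurent_repr_add)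

lemma laurent_repr_if:
  "laurent_repr a f \<Longrightarrow> laurent_repr b g \<Longrightarrow>
     laurent_repr (if P then a else b) (\<lambda>z. if P then f z else g z)"
  by simp

text \<open>A power of \<open>q\<close> turns \<open>a - b\<close> into an integer polynomial
  vanishing at all primitive roots, hence divisible by the cyclotomic polynomial; that power is a
  unit of the Laurent ring and can be undone.\<close>

lemma laurent_congI:
  assumes n: "n > 0" and "laurent_repr a f" "laurent_repr b g"
    and eq: "\<And>z. primitive_root n z \<Longrightarrow> f z = g z"
  shows "[a \<equiv>\<^sub>L b] (mod cyclotomic n)"
proof -
  have "laurent_repr (a + - 1 * b) (\<lambda>z. f z + - 1 * g z)"
    by (intro laurent_repr_add laurent_repr_mult laurent_repr_uminus_1 assms)
  then obtain P N where P: "(a - b) * qpow (int N) = laurent_of_poly P"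
    "\<And>z. z \<noteq> 0 \<Longrightarrow> (f z - g z) * z ^ N = poly (map_poly of_int P) z"
    unfolding laurent_repr_def by auto
  have "cyclotomic n dvd P"
  proof (rule cyclotomic_dvd[OF n])
    fix z :: complex assume z: "primitive_root n z"
    then show "poly (map_poly of_int P) z = 0"
      using P(2)[OF primitive_root_nonzero[OF z n]] eq[OF z] by simp
  qed
  then obtain R where R: "P = cyclotomic n * R" by (elim dvdE)
  then have "(a - b) * qpow (int N) * qpow (- int N) = laurent_of_poly (cyclotomic n) * (laurent_of_poly R * qpow (- int N))"
    by (simp only: P(1) R laurent_of_poly_mult mult.assoc)
  moreover have "qpow (int N) * qpow (- int N) = 1"
    by (simp add: qpow_0 flip: qpow_add)
  ultimately show ?thesis
    unfolding laurent_cong_def by (metis dvd_triv_left mult.assoc mult.right_neutral)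
qed

section \<open>Evaluating the integer polynomials\<close>

text \<open>Links the quotient definition to the recursion of \<open>gauss\<close>. The common
  denominator \<open>?D\<close> is a nonzero polynomial and can be cancelled before any root of
  unity is substituted.\<close>

lemma qbinomial_pascal:
  "qbinomial (Suc n) (Suc k) = qbinomial n k + qvar ^ Suc k * qbinomial n (Suc k)"
proof (cases "k < n")
  case True
  define i where "i = n - Suc k"
  have n: "n = Suc (k + i)" using True by (simp add: i_def)
  let ?P = "qpochhammer qvar"
  have 1: "qbinomial n k * (?P k * (?P i * (1 - qvar ^ Suc i))) = ?P n"
    using qbinomial_exact[of k n] qpochhammer_qvar_Suc[of i] n by simp
  have 2: "qbinomial n (Suc k) * (?P k * (1 - qvar ^ Suc k) * ?P i) = ?P n"
    using qbinomial_exact[of "Suc k" n] qpochhammer_qvar_Suc[of k] n by simp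
  have 3: "qbinomial (Suc n) (Suc k) * (?P k * (1 - qvar ^ Suc k) * (?P i * (1 - qvar ^ Suc i)))
      = ?P n * (1 - qvar ^ Suc n)"
    using qbinomial_exact[of "Suc k" "Suc n"] qpochhammer_qvar_Suc[of k] qpochhammer_qvar_Suc[of i]
      qpochhammer_qvar_Suc[of n] n by simp
  let ?D = "?P k * (1 - qvar ^ Suc k) * (?P i * (1 - qvar ^ Suc i))"
  have "(qbinomial n k + qvar ^ Suc k * qbinomial n (Suc k)) * ?D
      = qbinomial n k * (?P k * (?P i * (1 - qvar ^ Suc i))) * (1 - qvar ^ Suc k)
        + qvar ^ Suc k * (qbinomial n (Suc k) * (?P k * (1 - qvar ^ Suc k) * ?P i) * (1 - qvar ^ Suc i))"
    by (simp only: ring_distribs mult_ac)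
  also have "\<dots> = ?P n * (1 - qvar ^ Suc n)"
    unfolding 1 2 using q_pascal_aux[of "?P n" qvar k i] by (simp only: n)
  also have "\<dots> = qbinomial (Suc n) (Suc k) * ?D" using 3 by (rule sym)
  finally have "(qbinomial n k + qvar ^ Suc k * qbinomial n (Suc k)) * ?D
      = qbinomial (Suc n) (Suc k) * ?D" .
  moreover have "?D \<noteq> 0"
    using qpochhammer_qvar_neq_0 one_minus_qvar_power_neq_0[of "Suc k"] one_minus_qvar_power_neq_0[of "Suc i"]
    by (simp only: mult_eq_0_iff) simp
  ultimately show ?thesis by (metis mult_right_cancel)
next
  case False
  have "qbinomial m m = 1" for m
    using qpochhammer_qvar_neq_0[of m] by (simp add: qbinomial_def qpochhammer_0)
  then show ?thesis
    using False by (cases "k = n") (simp_all add: qbinomial_def)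
qed

lemma poly_qbinomial: "poly (map_poly of_int (qbinomial n k)) z = gauss (z :: 'a::field) n (int k)"
proof (induction n arbitrary: k)
  case 0
  show ?case by (cases k) (simp_all add: qbinomial_def qpochhammer_0)
next
  case (Suc n)
  show ?case
  proof (cases k)
    case 0
    then show ?thesis
      using qpochhammer_qvar_neq_0[of "Suc n"] by (simp add: qbinomial_def qpochhammer_0 del: gauss.simps)
  next
    case (Suc j)
    then show ?thesis
      unfolding Suc qbinomial_pascal of_int_poly_add of_int_poly_mult poly_add poly_mult
        of_int_poly_qvar_power Suc.IH
      by (simp flip: power_int_of_nat)
  qed
qed

text \<open>First \<open>t = s\<close>, then \<open>q = z\<close> is substituted; both sides then
  obey the recurrence \<open>fibq_rec\<close> with initial values 1.\<close>

lemma poly_qfib: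
  assumes "z \<noteq> 0"
  shows "poly (map_poly of_int (poly (qfib (Suc m)) s)) z = fibq z (poly (map_poly of_int s) z) m"
proof (induction m rule: induct_nat_012)
  case (ge2 m)
  then show ?case
    by (simp add: fibq_rec[OF assms] poly_monom of_int_poly_add of_int_poly_mult of_int_poly_qvar_power
        del: power_Suc mult_pCons_left mult_pCons_right)
next
  case 1
  then show ?case by (simp add: of_int_poly_mult poly_monom)
qed auto

section \<open>Both congruences, by comparison of values at primitive roots\<close>

theorem theorem6p3:
  fixes n :: nat
  assumes "n > 0"
  shows "[(\<Sum>k = 0..n - 1. (-1) ^ k * qpow (- int (k choose 2)) * laurent_of_poly (qcatalan k))
           \<equiv>\<^sub>L laurent_of_poly (poly (qfib n) qvar + poly (qfib (n + 2)) 1 - 2)]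
           (mod cyclotomic n)
       \<and> [laurent_of_poly (poly (qfib n) qvar + poly (qfib (n + 2)) 1)
           \<equiv>\<^sub>L (if n mod 5 \<in> {0, 2, 3}
                then (-1) ^ rnd5 n *
                       (qpow ((int (rnd5 n) * (int n - 1)) div 2)
                        + qpow ((int (rnd5 n) * (int n + 1)) div 2))
                else (-1) ^ rnd5 n *
                       (qpow ((int (rnd5 n) * (int n - 2)) div 2)
                        + qpow ((int (rnd5 n) * int n) div 2)
                        + qpow ((int (rnd5 n) * (int n + 2)) div 2)))]
           (mod cyclotomic n)"
proof
  let ?h = "map_poly (of_int :: int \<Rightarrow> complex)"
  let ?F = "poly (qfib n) qvar + poly (qfib (n + 2)) 1"
  have F: "poly (?h ?F) z = fibq z z (n - 1) + fibq z 1 (n + 1)" if "primitive_root n z" for z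
  proof -
    have z0: "z \<noteq> 0" using primitive_root_nonzero[OF that assms] .
    have "poly (?h (poly (qfib n) qvar)) z = fibq z z (n - 1)"
      using poly_qfib[OF z0, of "n - 1" qvar] assms of_int_poly_qvar_power[of 1 z] by simp
    moreover have "poly (?h (poly (qfib (n + 2)) 1)) z = fibq z 1 (n + 1)"
      using poly_qfib[OF z0, of "n + 1" 1] by (simp del: qfib.simps)
    ultimately show ?thesis by (simp add: of_int_poly_add del: qfib.simps)
  qed
  show "[(\<Sum>k = 0..n - 1. (-1) ^ k * qpow (- int (k choose 2)) * laurent_of_poly (qcatalan k))
           \<equiv>\<^sub>L laurent_of_poly (?F - 2)] (mod cyclotomic n)"
  proof (rule laurent_congI[OF assms laurent_repr_sum laurent_repr_poly])
    show "laurent_repr ((-1) ^ k * qpow (- int (k choose 2)) * laurent_of_poly (qcatalan k))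
        (\<lambda>z. (-1) ^ k * z powi (- int (k choose 2)) * poly (?h (qcatalan k)) z)" for k
      by (intro laurent_repr_mult laurent_repr_power laurent_repr_uminus_1 laurent_repr_qpow laurent_repr_poly)
  next
    fix z :: complex assume z: "primitive_root n z"
    have z0: "z \<noteq> 0" using primitive_root_nonzero[OF z assms] .
    let ?e = "\<lambda>k. (-1) ^ k * z powi (- int (k choose 2))"
    \<comment> \<open>The difference form of the q-Catalan number is used because it can be
      evaluated at \<open>z\<close> without division.\<close>
    have "?h (qcatalan k) = ?h (qbinomial (2 * k) k + - qvar * qbinomial (2 * k) (k + 1))" for k
      by (simp only: qcatalan_eq diff_conv_add_uminus mult_minus_left)
    then have cat: "poly (?h (qcatalan k)) z = gauss z (2 * k) (int k) - z * gauss z (2 * k) (int (k + 1))" for k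
      by (simp only: of_int_poly_add of_int_poly_mult poly_add poly_mult poly_qbinomial) (simp add: map_poly_pCons)
    have "?e k * poly (?h (qcatalan k)) z = ?e k * gauss z (2 * k) (int k)
        - (-1) ^ k * z powi (1 - int (k choose 2)) * gauss z (2 * k) (int (k + 1))" for k
    proof -
      have "z powi (1 - int (k choose 2)) = z * z powi (- int (k choose 2))"
        using z0 power_int_add[of z 1 "- int (k choose 2)"] by simp
      then show ?thesis by (simp only: cat) (simp add: algebra_simps)
    qed
    moreover have "{0..n - 1} = {..<n}" using assms by auto
    \<comment> \<open>The first sum is \<open>fibq z z (n - 1)\<close>; the subtracted one is
      \<open>2 - fibq z 1 (n + 1)\<close>, whence the constant -2.\<close>
    ultimately have "(\<Sum>k = 0..n - 1. ?e k * poly (?h (qcatalan k)) z)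
        = fibq z z (n - 1) + fibq z 1 (n + 1) - 2"
      by (simp only: sum_subtractf fibq_q_root[OF z assms] fibq_1_root[OF z assms]) simp
    also have "\<dots> = poly (?h (?F + [:- 2:])) z"
      unfolding of_int_poly_add[of _ "[:- 2:]"] poly_add F[OF z] by (simp add: map_poly_pCons)
    also have "?F + [:- 2:] = ?F - 2"
      by (simp add: numeral_poly)
    finally show "(\<Sum>k = 0..n - 1. ?e k * poly (?h (qcatalan k)) z) = poly (?h (?F - 2)) z" .
  qed
  have "laurent_repr
          (if n mod 5 \<in> {0, 2, 3}
                then (-1) ^ rnd5 n *
                       (qpow ((int (rnd5 n) * (int n - 1)) div 2)
                        + qpow ((int (rnd5 n) * (int n + 1)) div 2))
                else (-1) ^ rnd5 n *
                       (qpow ((int (rnd5 n) * (int n - 2)) div 2)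
                        + qpow ((int (rnd5 n) * int n) div 2)
                        + qpow ((int (rnd5 n) * (int n + 2)) div 2)))
          (\<lambda>z. (if n mod 5 \<in> {0, 2, 3}
                then (-1) ^ rnd5 n *
                       (z powi ((int (rnd5 n) * (int n - 1)) div 2)
                        + z powi ((int (rnd5 n) * (int n + 1)) div 2))
                else (-1) ^ rnd5 n *
                       (z powi ((int (rnd5 n) * (int n - 2)) div 2)
                        + z powi ((int (rnd5 n) * int n) div 2)
                        + z powi ((int (rnd5 n) * (int n + 2)) div 2))))"
    by (intro laurent_repr_if laurent_repr_mult laurent_repr_add laurent_repr_power
        laurent_repr_uminus_1 laurent_repr_qpow)
  from laurent_congI[OF assms laurent_repr_poly this]
  show "[laurent_of_poly ?F
           \<equiv>\<^sub>L (if n mod 5 \<in> {0, 2, 3}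
                then (-1) ^ rnd5 n *
                       (qpow ((int (rnd5 n) * (int n - 1)) div 2)
                        + qpow ((int (rnd5 n) * (int n + 1)) div 2))
                else (-1) ^ rnd5 n *
                       (qpow ((int (rnd5 n) * (int n - 2)) div 2)
                        + qpow ((int (rnd5 n) * int n) div 2)
                        + qpow ((int (rnd5 n) * (int n + 2)) div 2)))]
           (mod cyclotomic n)"
    by (simp only: F fibq_root_sum_cases[OF _ assms])
qed

end
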